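(* Let $X$ be a real or complex Banach space, let $A:\mathbb{N}\to\mathcal{B}(X)$ be a sequence of bounded linear operators on $X$, and consider the linear discrete-time system $x_{n+1}=A(n)x_n$ with associated operators $\mathcal{A}_m^n$ ($m\ge n$). The system is power instable if and only if there exist constants $D\ge 1$, $d>1$ and $c\in[1,d)$ such that $$\sum_{k=n}^{m} d^{\,m-k}\,\|\mathcal{A}_k^n x\|\le D\,c^{m}\,\|\mathcal{A}_m^n x\|\qquad\text{for all } (m,n)\in\Delta \text{ and all } x\in X.$$
   Context: $\mathbb{N}$ denotes the set of all positive integers. $\mathcal{B}(X)$ is the Banach algebra of all bounded linear operators from $X$ into itself; the norms on $X$ and on $\mathcal{B}(X)$ are both denoted $\|\cdot\|$. $\Delta$ is the set of all pairs $(m,n)$ of positive integers with $m\ge n$. $T$ is the set of all triplets $(m,n,p)$ of positive integers with $(m,n)\in\Delta$ and $(n,p)\in\Delta$ (i.e. $m\ge n\ge p$). For $(m,n)\in\Delta$ the operators associated with the system are defined by $\mathcal{A}_m^n=A(m)\cdot A(m-1)\cdots A(n+1)$ if $m>n$, and $\mathcal{A}_m^n=I$ (the identity on $X$) if $m=n$. The system is called power instable if there are constants $N\ge 1$, $r\in(0,1)$ and $s\ge 1$ such that $\|\mathcal{A}_n^p x\|\le N r^{m-n}s^{n}\|\mathcal{A}_m^p x\|$ for all $(m,n,p)\in T$ and all $x\in X$. *)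

theory Defs
  imports "HOL-Analysis.Analysis"
begin

text \<open>
  Scalars: the space is a type of class \<open>banach\<close> and its operators are the real-linear bounded
  operators \<open>'a \<Rightarrow>\<^sub>L 'a\<close>. This covers complex Banach spaces as well: such a space is a real Banach
  space with the same norm, and its complex-linear bounded operators are among the real-linear ones.

  Time: the positive integers are the elements of \<open>nat\<close> that are at least \<open>1\<close>. A sequence
  is a total function on \<open>nat\<close>, but its value at \<open>0\<close> is never used for indices in \<open>\<Delta>\<close>.
\<close>

definition Delta :: "(nat \<times> nat) set" (\<open>\<Delta>\<close>) where
  "\<Delta> = {(m, n). 1 \<le> m \<and> 1 \<le> n \<and> n \<le> m}"

definition Triples :: "(nat \<times> nat \<times> nat) set" where
  "Triples = {(m, n, p). (m, n) \<in> \<Delta> \<and> (n, p) \<in> \<Delta>}"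

text \<open>
  \<open>evol A m n = A m o\<^sub>L A (m - 1) o\<^sub>L \<dots> o\<^sub>L A (n + 1)\<close> for \<open>n < m\<close>, and the identity for \<open>m = n\<close>.
  The value for \<open>m < n\<close> is arbitrary (here also the identity).
\<close>

primrec evol :: "(nat \<Rightarrow> 'a::real_normed_vector \<Rightarrow>\<^sub>L 'a) \<Rightarrow> nat \<Rightarrow> nat \<Rightarrow> 'a \<Rightarrow>\<^sub>L 'a" where
  "evol A 0 n = id_blinfun"
| "evol A (Suc m) n = (if n < Suc m then A (Suc m) o\<^sub>L evol A m n else id_blinfun)"

definition power_instable :: "(nat \<Rightarrow> 'a::real_normed_vector \<Rightarrow>\<^sub>L 'a) \<Rightarrow> bool" where
  "power_instable A \<longleftrightarrow>
    (\<exists>N r s :: real. N \<ge> 1 \<and> 0 < r \<and> r < 1 \<and> s \<ge> 1 \<and>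
      (\<forall>(m, n, p) \<in> Triples. \<forall>x.
        norm (evol A n p x) \<le> N * r ^ (m - n) * s ^ n * norm (evol A m p x)))"

end

theory Submission
  imports Defs
begin

text \<open>
  Fix \<open>n\<close> and \<open>x\<close> and put \<open>a k = norm (evol A k n x)\<close>; both conditions compare the earlier terms
  of this nonnegative sequence with \<open>a m\<close>, with constants that depend on neither \<open>n\<close> nor \<open>x\<close>.

  A bound on the weighted sum bounds each of its terms, so \<open>d ^ (m - k) * a k \<le> D * c ^ m * a m\<close>.
  Since \<open>c ^ m = c ^ (m - k) * c ^ k\<close>, this is power instability with \<open>r = c / d\<close> and \<open>s = c\<close>; the
  requirement \<open>c < d\<close> is what makes \<open>r < 1\<close> (lemma \<open>term_le_if_weighted_sum_le\<close>).

  Conversely, inserting \<open>a k \<le> N * r ^ (m - k) * s ^ k * a m\<close> into the weighted sum leaves the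
  factor \<open>\<Sum>k. (d * r) ^ (m - k) * s ^ k\<close>. If \<open>d\<close> is so large that \<open>d * r = 2 * s\<close>, this equals
  \<open>(2 * s) ^ m\<close> times a sum of powers of \<open>1/2\<close>, hence is at most \<open>2 * (2 * s) ^ m\<close>. Thus
  \<open>d = 2 * s / r\<close>, \<open>c = 2 * s\<close> and \<open>D = 2 * N\<close> will do, and \<open>c < d\<close> because \<open>r < 1\<close>
  (lemmas \<open>sum_doubled_powers_le\<close> and \<open>weighted_sum_le_if_terms_le\<close>).
\<close>

text \<open>
  The summand is \<open>(2 * s) ^ m * (1/2) ^ k\<close>, and \<open>\<Sum>k. (1/2) ^ k = 2\<close>; the bound is therefore
  independent of the number of terms.
\<close>

lemma sum_doubled_powers_le:
  fixes s :: real
  assumes "0 \<le> s"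
  shows "(\<Sum>k = n..m. (2 * s) ^ (m - k) * s ^ k) \<le> 2 * (2 * s) ^ m"
proof -
  have "(\<Sum>k = n..m. (2 * s) ^ (m - k) * s ^ k) = (\<Sum>k = n..m. (2 * s) ^ m * (1/2) ^ k)"
  proof (rule sum.cong[OF refl])
    fix k assume "k \<in> {n..m}"
    then have "(2 * s) ^ m = (2 * s) ^ (m - k) * (2 * s) ^ k"
      using power_add[of "2 * s" "m - k" k] by simp
    then show "(2 * s) ^ (m - k) * s ^ k = (2 * s) ^ m * (1/2) ^ k"
      by (simp add: power_mult_distrib power_one_over)
  qed
  also have "\<dots> = (2 * s) ^ m * (\<Sum>k = n..m. (1/2) ^ k)"
    by (simp add: sum_distrib_left)
  also have "\<dots> \<le> (2 * s) ^ m * 2"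
  proof (rule mult_left_mono)
    have "(\<Sum>k = n..m. (1/2 :: real) ^ k) \<le> (\<Sum>k < Suc m. (1/2) ^ k)"
      by (intro sum_mono2) auto
    also have "\<dots> \<le> 2"
      by (simp add: geometric_sum del: sum.lessThan_Suc)
    finally show "(\<Sum>k = n..m. (1/2 :: real) ^ k) \<le> 2" .
  qed (use assms in simp)
  finally show ?thesis by (simp add: mult.commute)
qed

lemma weighted_sum_le_if_terms_le:
  fixes a :: "nat \<Rightarrow> real"
  assumes "0 < r" "0 \<le> s" "0 \<le> N" "0 \<le> a m"
    and terms: "\<And>k. n \<le> k \<Longrightarrow> k \<le> m \<Longrightarrow> a k \<le> N * r ^ (m - k) * s ^ k * a m"
  shows "(\<Sum>k = n..m. (2 * s / r) ^ (m - k) * a k) \<le> 2 * N * (2 * s) ^ m * a m"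
proof -
  have "(\<Sum>k = n..m. (2 * s / r) ^ (m - k) * a k)
      \<le> (\<Sum>k = n..m. N * a m * ((2 * s) ^ (m - k) * s ^ k))"
  proof (rule sum_mono)
    fix k assume "k \<in> {n..m}"
    then have "(2 * s / r) ^ (m - k) * a k
        \<le> (2 * s / r) ^ (m - k) * (N * r ^ (m - k) * s ^ k * a m)"
      using terms[of k] assms(1,2) by (intro mult_left_mono) auto
    also have "\<dots> = N * a m * ((2 * s) ^ (m - k) * s ^ k)"
      using \<open>0 < r\<close> by (simp add: power_divide)
    finally show "(2 * s / r) ^ (m - k) * a k \<le> N * a m * ((2 * s) ^ (m - k) * s ^ k)" .
  qed
  also have "\<dots> = N * a m * (\<Sum>k = n..m. (2 * s) ^ (m - k) * s ^ k)"
    by (simp add: sum_distrib_left)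
  also have "\<dots> \<le> N * a m * (2 * (2 * s) ^ m)"
    using assms by (intro mult_left_mono sum_doubled_powers_le) auto
  finally show ?thesis by (simp add: mult_ac)
qed

lemma term_le_if_weighted_sum_le:
  fixes a :: "nat \<Rightarrow> real"
  assumes "0 < d" "n \<le> k" "k \<le> m" and nonneg: "\<And>j. 0 \<le> a j"
    and sum_le: "(\<Sum>j = n..m. d ^ (m - j) * a j) \<le> D * c ^ m * a m"
  shows "a k \<le> D * (c / d) ^ (m - k) * c ^ k * a m"
proof -
  have "d ^ (m - k) * a k \<le> (\<Sum>j = n..m. d ^ (m - j) * a j)"
    using assms by (intro member_le_sum) auto
  also note sum_le
  also have "c ^ m = c ^ (m - k) * c ^ k"
    using \<open>k \<le> m\<close> power_add[of c "m - k" k] by simp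
  finally have "a k \<le> D * (c ^ (m - k) * c ^ k) * a m / d ^ (m - k)"
    using \<open>0 < d\<close> by (simp add: pos_le_divide_eq mult_ac)
  then show ?thesis by (simp add: power_divide mult_ac)
qed

theorem theorem2p1:
  fixes A :: "nat \<Rightarrow> 'a::banach \<Rightarrow>\<^sub>L 'a"
  shows "power_instable A \<longleftrightarrow>
    (\<exists>D d c :: real. D \<ge> 1 \<and> d > 1 \<and> 1 \<le> c \<and> c < d \<and>
      (\<forall>(m, n) \<in> \<Delta>. \<forall>x.
        (\<Sum>k = n..m. d ^ (m - k) * norm (evol A k n x)) \<le> D * c ^ m * norm (evol A m n x)))"
    (is "_ \<longleftrightarrow> ?sum_bound")
proof
  assume "power_instable A"
  then obtain N r s :: real where N: "1 \<le> N" and r: "0 < r" "r < 1" and s: "1 \<le> s"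
    and inst: "\<And>m n p x. (m, n, p) \<in> Triples \<Longrightarrow>
      norm (evol A n p x) \<le> N * r ^ (m - n) * s ^ n * norm (evol A m p x)"
    unfolding power_instable_def by fast
  have "2 * s < 2 * s / r"
    using r s by (simp add: less_divide_eq)
  moreover have "(\<Sum>k = n..m. (2 * s / r) ^ (m - k) * norm (evol A k n x))
      \<le> 2 * N * (2 * s) ^ m * norm (evol A m n x)" if "(m, n) \<in> \<Delta>" for m n x
  proof (rule weighted_sum_le_if_terms_le)
    fix k assume "n \<le> k" "k \<le> m"
    with that have "(m, k, n) \<in> Triples"
      by (auto simp: Triples_def Delta_def)
    then show "norm (evol A k n x) \<le> N * r ^ (m - k) * s ^ k * norm (evol A m n x)"
      by (rule inst)
  qed (use N r s in auto)
  ultimately show ?sum_bound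
    using N s by (intro exI[of _ "2 * N"] exI[of _ "2 * s / r"] exI[of _ "2 * s"]) auto
next
  assume ?sum_bound
  then obtain D d c :: real where D: "1 \<le> D" and d: "1 < d" and c: "1 \<le> c" "c < d"
    and sum_le: "\<And>m n x. (m, n) \<in> \<Delta> \<Longrightarrow>
      (\<Sum>k = n..m. d ^ (m - k) * norm (evol A k n x)) \<le> D * c ^ m * norm (evol A m n x)"
    by fast
  have "norm (evol A n p x) \<le> D * (c / d) ^ (m - n) * c ^ n * norm (evol A m p x)"
    if "(m, n, p) \<in> Triples" for m n p x
  proof (rule term_le_if_weighted_sum_le)
    show "p \<le> n" "n \<le> m" using that by (auto simp: Triples_def Delta_def)
    have "(m, p) \<in> \<Delta>" using that by (auto simp: Triples_def Delta_def)
    then show "(\<Sum>k = p..m. d ^ (m - k) * norm (evol A k p x)) \<le> D * c ^ m * norm (evol A m p x)"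
      by (rule sum_le)
  qed (use d in auto)
  then show "power_instable A"
    unfolding power_instable_def
    using D d c by (intro exI[of _ D] exI[of _ "c / d"] exI[of _ c]) auto
qed

end
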